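(* Let $b>0$, $f(t)=b\cosh t$, $g(t)=bt$, and consider the catenoid $\mathbf{x}(t,v)=(f(t)\cos v,\,f(t)\sin v,\,g(t))$. Its unit normal is $$\mathbf{n}(t,v)=\left(-\frac{\cos v}{\cosh t},\,-\frac{\sin v}{\cosh t},\,\tanh t\right),$$ the non-vanishing coefficients of its first and second fundamental forms are $$E=b^2\cosh^2 t,\quad G=b^2\cosh^2 t,\quad L=-b,\quad N=b,$$ and its principal, mean and Gaussian curvatures are $$k_1=\frac{-1}{b\cosh^2 t},\quad k_2=\frac{1}{b\cosh^2 t},\quad H=0,\quad K=\frac{-1}{b^2\cosh^4 t}.$$ The geodesic curvature of the parallel at parameter $t$ is $k_g(t)=\dfrac{\sinh t}{b\cosh^2 t}$. For $t_1<t_2$ and $v_1<v_2$, the total curvature of $\mathbf{x}$ over $[t_1,t_2]\times[v_1,v_2]$ is $$\int_{\mathbf{x}}K\,d\sigma=-(v_2-v_1)\,(\tanh t_2-\tanh t_1).$$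
   Context: For a surface of revolution $\mathbf{x}(t,v)=(f(t)\cos v,f(t)\sin v,g(t))$ with $f>0$, the unit normal is $\mathbf{n}=\frac{\mathbf{x}_t\times\mathbf{x}_v}{|\mathbf{x}_t\times\mathbf{x}_v|}$, and $E=\langle\mathbf{x}_t,\mathbf{x}_t\rangle$, $F=\langle\mathbf{x}_t,\mathbf{x}_v\rangle$, $G=\langle\mathbf{x}_v,\mathbf{x}_v\rangle$, $L=\langle\mathbf{x}_{tt},\mathbf{n}\rangle$, $M=\langle\mathbf{x}_{tv},\mathbf{n}\rangle$, $N=\langle\mathbf{x}_{vv},\mathbf{n}\rangle$. The principal curvatures are $k_1=L/E$, $k_2=N/G$, the mean curvature is $H=(k_1+k_2)/2$, and the Gaussian curvature is $K=LN/(EG)$. The geodesic curvature of an arc-length parametrized curve $\alpha$ in the surface is $k_g=\langle\alpha'',\mathbf{u}\rangle$, where $\mathbf{u}$ is the unit tangent vector to the surface with $\alpha'\times\mathbf{u}=\mathbf{n}$; the parallel at parameter $t$ is the curve $v\mapsto\mathbf{x}(t,v)$ traversed with $v$ increasing. The area element is $d\sigma=|\mathbf{x}_t|\,|\mathbf{x}_v|\,dt\,dv$. *)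

theory Defs
  imports "HOL-Analysis.Analysis"
begin

type_synonym psurface = "real \<Rightarrow> real \<Rightarrow> real^3"

definition surface_of_revolution :: "(real \<Rightarrow> real) \<Rightarrow> (real \<Rightarrow> real) \<Rightarrow> psurface" where
  "surface_of_revolution f g t v = vector [f t * cos v, f t * sin v, g t]"

definition deriv_t :: "psurface \<Rightarrow> psurface" where
  "deriv_t x t v = vector_derivative (\<lambda>s. x s v) (at t)"

definition deriv_v :: "psurface \<Rightarrow> psurface" where
  "deriv_v x t v = vector_derivative (\<lambda>w. x t w) (at v)"

definition unit_normal :: "psurface \<Rightarrow> psurface" where
  "unit_normal x t v =
     (let w = cross3 (deriv_t x t v) (deriv_v x t v) in (1 / norm w) *\<^sub>R w)"

definition coeff_E :: "psurface \<Rightarrow> real \<Rightarrow> real \<Rightarrow> real" where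
  "coeff_E x t v = deriv_t x t v \<bullet> deriv_t x t v"

definition coeff_F :: "psurface \<Rightarrow> real \<Rightarrow> real \<Rightarrow> real" where
  "coeff_F x t v = deriv_t x t v \<bullet> deriv_v x t v"

definition coeff_G :: "psurface \<Rightarrow> real \<Rightarrow> real \<Rightarrow> real" where
  "coeff_G x t v = deriv_v x t v \<bullet> deriv_v x t v"

definition coeff_L :: "psurface \<Rightarrow> real \<Rightarrow> real \<Rightarrow> real" where
  "coeff_L x t v = deriv_t (deriv_t x) t v \<bullet> unit_normal x t v"

definition coeff_M :: "psurface \<Rightarrow> real \<Rightarrow> real \<Rightarrow> real" where
  "coeff_M x t v = deriv_v (deriv_t x) t v \<bullet> unit_normal x t v"

definition coeff_N :: "psurface \<Rightarrow> real \<Rightarrow> real \<Rightarrow> real" where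
  "coeff_N x t v = deriv_v (deriv_v x) t v \<bullet> unit_normal x t v"

(* The formulas for the curvatures below are the ones valid for surfaces of
   revolution, where F = M = 0. *)

definition principal_curvature1 :: "psurface \<Rightarrow> real \<Rightarrow> real \<Rightarrow> real" where
  "principal_curvature1 x t v = coeff_L x t v / coeff_E x t v"

definition principal_curvature2 :: "psurface \<Rightarrow> real \<Rightarrow> real \<Rightarrow> real" where
  "principal_curvature2 x t v = coeff_N x t v / coeff_G x t v"

definition mean_curvature :: "psurface \<Rightarrow> real \<Rightarrow> real \<Rightarrow> real" where
  "mean_curvature x t v = (principal_curvature1 x t v + principal_curvature2 x t v) / 2"

definition gauss_curvature :: "psurface \<Rightarrow> real \<Rightarrow> real \<Rightarrow> real" where
  "gauss_curvature x t v =
     (coeff_L x t v * coeff_N x t v) / (coeff_E x t v * coeff_G x t v)"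

(* A curve in the surface is given by its coordinates c s = (t, v) in the parameter
   domain, so that the normal along it is determined even where x is not injective. *)

definition surface_curve :: "psurface \<Rightarrow> (real \<Rightarrow> real \<times> real) \<Rightarrow> real \<Rightarrow> real^3" where
  "surface_curve x c s = x (fst (c s)) (snd (c s))"

definition velocity :: "(real \<Rightarrow> real^3) \<Rightarrow> real \<Rightarrow> real^3" where
  "velocity \<alpha> s = vector_derivative \<alpha> (at s)"

definition arc_length_parametrized :: "(real \<Rightarrow> real^3) \<Rightarrow> bool" where
  "arc_length_parametrized \<alpha> \<longleftrightarrow> (\<forall>s. \<alpha> differentiable (at s) \<and> norm (velocity \<alpha> s) = 1)"

definition conormal :: "psurface \<Rightarrow> (real \<Rightarrow> real \<times> real) \<Rightarrow> real \<Rightarrow> real^3" where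
  "conormal x c s = (case c s of (t, v) \<Rightarrow>
     (THE u. u \<in> span {deriv_t x t v, deriv_v x t v} \<and> norm u = 1 \<and>
             cross3 (velocity (surface_curve x c) s) u = unit_normal x t v))"

(* Meaningful only when the curve is arc-length parametrized. *)
definition geodesic_curvature :: "psurface \<Rightarrow> (real \<Rightarrow> real \<times> real) \<Rightarrow> real \<Rightarrow> real" where
  "geodesic_curvature x c s = velocity (velocity (surface_curve x c)) s \<bullet> conormal x c s"

(* The coordinate curve s \<mapsto> (t, \<phi> s) is the parallel at t, traversed by arc length
   with v = \<phi> s increasing. *)
definition arc_length_parallel :: "psurface \<Rightarrow> real \<Rightarrow> (real \<Rightarrow> real \<times> real) \<Rightarrow> bool" where
  "arc_length_parallel x t c \<longleftrightarrow>
     (\<exists>\<phi>. c = (\<lambda>s. (t, \<phi> s)) \<and> surj \<phi> \<and>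
          (\<forall>s. \<phi> differentiable (at s) \<and> deriv \<phi> s > 0)) \<and>
     arc_length_parametrized (surface_curve x c)"

definition total_curvature ::
    "psurface \<Rightarrow> real \<Rightarrow> real \<Rightarrow> real \<Rightarrow> real \<Rightarrow> real" where
  "total_curvature x t1 t2 v1 v2 =
     (LINT p:({t1..t2} \<times> {v1..v2})|lborel.
        gauss_curvature x (fst p) (snd p) *
        (norm (deriv_t x (fst p) (snd p)) * norm (deriv_v x (fst p) (snd p))))"

end

(* The parallel at t is a circle of radius b cosh t, so its angular speed at unit speed is
   1 / (b cosh t).  A unit vector u with alpha' x u = n must be orthogonal to alpha', hence
   u = n x alpha', which on a parallel is - x_t / |x_t|.  The total curvature density
   K |x_t| |x_v| is independent of v and equals the t-derivative of - tanh t. *)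
theory Submission
  imports Defs
begin

section \<open>Calculus and algebra of explicit vectors in three-space\<close>

text \<open>Expanding along the axis vectors gives a sum of scalar functions times fixed vectors, to
  which the sum and scaling rules apply.\<close>

lemma has_vector_derivative_vector_3:
  fixes p q r :: "real \<Rightarrow> real"
  assumes "(p has_real_derivative p') (at s within S)" "(q has_real_derivative q') (at s within S)"
    "(r has_real_derivative r') (at s within S)"
  shows "((\<lambda>s. vector [p s, q s, r s] :: real^3) has_vector_derivative vector [p', q', r'])
    (at s within S)"
proof -
  have axes: "(vector [x, y, z] :: real^3) = x *\<^sub>R axis 1 1 + y *\<^sub>R axis 2 1 + z *\<^sub>R axis 3 1"
    for x y z :: real
    by (simp add: vec_eq_iff forall_3 axis_def)
  have scale: "((\<lambda>s. h s *\<^sub>R w) has_vector_derivative h' *\<^sub>R w) (at s within S)"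
    if "(h has_real_derivative h') (at s within S)" for h h' and w :: "real^3"
    using has_vector_derivative_scaleR[OF that has_vector_derivative_const[of w]] by simp
  show ?thesis
    unfolding axes by (intro has_vector_derivative_add scale assms)
qed

text \<open>Separating the derivatives \<open>p'\<close>, \<open>q'\<close>, \<open>r'\<close> from
  the wanted entries \<open>a\<close>, \<open>b\<close>, \<open>c\<close> leaves the former
  schematic in backward use: the differentiation rules may produce any form, and only an equation
  between the two has to be closed.\<close>

lemma vector_derivative_vector_3_at:
  fixes p q r :: "real \<Rightarrow> real"
  assumes "(p has_real_derivative p') (at s)" "(q has_real_derivative q') (at s)"
    "(r has_real_derivative r') (at s)"
    and "p' = a" "q' = b" "r' = c"
  shows "vector_derivative (\<lambda>s. vector [p s, q s, r s] :: real^3) (at s) = vector [a, b, c]"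
  using has_vector_derivative_vector_3[OF assms(1-3)] assms(4-6)
  by (simp add: vector_derivative_at)

lemma cross3_vector_3:
  fixes a b c d e f :: real
  shows "cross3 (vector [a, b, c]) (vector [d, e, f])
    = vector [b * f - c * e, c * d - a * f, a * e - b * d]"
  by (simp add: cross3_def)

lemma inner_vector_3:
  fixes a b c d e f :: real
  shows "vector [a, b, c] \<bullet> (vector [d, e, f] :: real^3) = a * d + b * e + c * f"
  by (simp add: inner_vec_def sum_3)

lemma scaleR_vector_3:
  fixes k a b c :: real
  shows "k *\<^sub>R (vector [a, b, c] :: real^3) = vector [k * a, k * b, k * c]"
  by (simp add: vec_eq_iff forall_3)

lemma norm_vector_3:
  fixes a b c :: real
  shows "norm (vector [a, b, c] :: real^3) = sqrt (a\<^sup>2 + b\<^sup>2 + c\<^sup>2)"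
  by (simp add: norm_eq_sqrt_inner inner_vector_3 power2_eq_square)

section \<open>The conormal as a cross product\<close>

text \<open>Uniqueness of the conormal. By Lagrange's identity, |a x u|^2 + (a . u)^2 = |a|^2 |u|^2,
  the three unit norms force a . u = 0; the triple product expansion of (a x u) x a then reduces to
  u.\<close>

lemma cross3_eq_imp_eq_cross3:
  fixes a u n :: "real^3"
  assumes "norm a = 1" "norm u = 1" "norm n = 1" "cross3 a u = n"
  shows "u = cross3 n a"
proof -
  have "a \<bullet> u = 0"
    using norm_cross_dot[of a u] assms by simp
  moreover have "cross3 (cross3 a u) a = (a \<bullet> a) *\<^sub>R u - (a \<bullet> u) *\<^sub>R a"
    by (simp add: cross3_simps forall_3)
  ultimately show ?thesis
    using assms by (simp add: dot_square_norm)
qed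

text \<open>Existence of the conormal, by the same triple product expansion with n in place of
  u.\<close>

lemma cross3_cross3_orthogonal:
  fixes a n :: "real^3"
  assumes "norm a = 1" "a \<bullet> n = 0"
  shows "cross3 a (cross3 n a) = n"
proof -
  have "cross3 a (cross3 n a) = (a \<bullet> a) *\<^sub>R n - (a \<bullet> n) *\<^sub>R a"
    by (simp add: cross3_simps forall_3)
  then show ?thesis
    using assms by (simp add: dot_square_norm)
qed

text \<open>Resolves the definite description in \<open>conormal\<close>. Tangency of the candidate
  is left as a hypothesis, because it depends on the surface.\<close>

lemma conormal_eq:
  assumes "c s = (t, v)" "velocity (surface_curve x c) s = a"
    and "norm a = 1" "norm (unit_normal x t v) = 1" "a \<bullet> unit_normal x t v = 0"
    and "cross3 (unit_normal x t v) a \<in> span {deriv_t x t v, deriv_v x t v}"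
  shows "conormal x c s = cross3 (unit_normal x t v) a"
proof -
  let ?n = "unit_normal x t v"
  have cr: "cross3 a (cross3 ?n a) = ?n"
    using assms by (intro cross3_cross3_orthogonal)
  \<comment> \<open>Lagrange's identity again, now for two orthogonal unit vectors.\<close>
  have nm: "norm (cross3 ?n a) = 1"
    using norm_cross_dot[of ?n a] assms by (simp add: inner_commute power2_eq_1_iff)
      (metis abs_norm_cancel abs_minus_cancel)
  show ?thesis
    unfolding conormal_def assms(1) prod.case assms(2)
  proof (rule the_equality)
    show "cross3 ?n a \<in> span {deriv_t x t v, deriv_v x t v} \<and> norm (cross3 ?n a) = 1
        \<and> cross3 a (cross3 ?n a) = ?n"
      using assms(6) nm cr by blast
    show "u = cross3 ?n a" if "u \<in> span {deriv_t x t v, deriv_v x t v} \<and> norm u = 1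
        \<and> cross3 a u = ?n" for u
      using that assms(3,4) by (intro cross3_eq_imp_eq_cross3) auto
  qed
qed

section \<open>The catenoid and its partial derivatives\<close>

definition catenoid :: "real \<Rightarrow> psurface" where
  "catenoid b = surface_of_revolution (\<lambda>t. b * cosh t) (\<lambda>t. b * t)"

text \<open>Stated as an equality of functions so that it can be rewritten inside a second partial
  derivative.\<close>

lemma deriv_t_catenoid:
  "deriv_t (catenoid b) = (\<lambda>t v. vector [b * sinh t * cos v, b * sinh t * sin v, b])"
  unfolding deriv_t_def catenoid_def surface_of_revolution_def
  by (intro ext vector_derivative_vector_3_at) (auto intro!: derivative_eq_intros)

lemma deriv_v_catenoid:
  "deriv_v (catenoid b) = (\<lambda>t v. vector [- b * cosh t * sin v, b * cosh t * cos v, 0])"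
  unfolding deriv_v_def catenoid_def surface_of_revolution_def
  by (intro ext vector_derivative_vector_3_at) (auto intro!: derivative_eq_intros)

lemma deriv_t_deriv_t_catenoid:
  "deriv_t (deriv_t (catenoid b)) t v = vector [b * cosh t * cos v, b * cosh t * sin v, 0]"
  \<comment> \<open>The inner derivative is replaced first; opening \<open>deriv_t_def\<close> at
    once would expand both occurrences of \<open>deriv_t\<close>.\<close>
  unfolding deriv_t_catenoid
  unfolding deriv_t_def
  by (intro vector_derivative_vector_3_at) (auto intro!: derivative_eq_intros)

lemma deriv_v_deriv_t_catenoid:
  "deriv_v (deriv_t (catenoid b)) t v = vector [- b * sinh t * sin v, b * sinh t * cos v, 0]"
  unfolding deriv_t_catenoid
  unfolding deriv_v_def
  by (intro vector_derivative_vector_3_at) (auto intro!: derivative_eq_intros)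

lemma deriv_v_deriv_v_catenoid:
  "deriv_v (deriv_v (catenoid b)) t v = vector [- b * cosh t * cos v, - b * cosh t * sin v, 0]"
  unfolding deriv_v_catenoid
  unfolding deriv_v_def
  by (intro vector_derivative_vector_3_at) (auto intro!: derivative_eq_intros)

section \<open>Fundamental forms and unit normal\<close>

text \<open>The Pythagorean identity as a rewrite rule. The computations below first bring their
  sums to this shape, with a common factor \<open>k\<close>, so that one rewrite removes v.\<close>

lemma cos_sin_combine:
  fixes k v :: real
  shows "k * (cos v)\<^sup>2 + k * (sin v)\<^sup>2 = k"
  by (metis distrib_left mult.right_neutral sin_cos_squared_add2)

lemma coeff_E_catenoid: "coeff_E (catenoid b) t v = b\<^sup>2 * (cosh t)\<^sup>2"
proof -
  have "coeff_E (catenoid b) t v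
      = (b\<^sup>2 * (sinh t)\<^sup>2) * (cos v)\<^sup>2 + (b\<^sup>2 * (sinh t)\<^sup>2) * (sin v)\<^sup>2 + b\<^sup>2"
    by (simp add: coeff_E_def deriv_t_catenoid inner_vector_3 power2_eq_square algebra_simps)
  then show ?thesis
    unfolding cos_sin_combine by (simp add: cosh_square_eq algebra_simps)
qed

lemma coeff_F_catenoid: "coeff_F (catenoid b) t v = 0"
  by (simp add: coeff_F_def deriv_t_catenoid deriv_v_catenoid inner_vector_3)

lemma coeff_G_catenoid: "coeff_G (catenoid b) t v = b\<^sup>2 * (cosh t)\<^sup>2"
proof -
  have "coeff_G (catenoid b) t v
      = (b\<^sup>2 * (cosh t)\<^sup>2) * (cos v)\<^sup>2 + (b\<^sup>2 * (cosh t)\<^sup>2) * (sin v)\<^sup>2"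
    by (simp add: coeff_G_def deriv_v_catenoid inner_vector_3 power2_eq_square algebra_simps)
  then show ?thesis
    unfolding cos_sin_combine .
qed

lemma norm_deriv_t_catenoid:
  assumes "b > 0"
  shows "norm (deriv_t (catenoid b) t v) = b * cosh t"
  using coeff_E_catenoid[of b t v] assms
  by (simp add: coeff_E_def norm_eq_sqrt_inner real_sqrt_mult)

lemma norm_deriv_v_catenoid:
  assumes "b > 0"
  shows "norm (deriv_v (catenoid b) t v) = b * cosh t"
  using coeff_G_catenoid[of b t v] assms
  by (simp add: coeff_G_def norm_eq_sqrt_inner real_sqrt_mult)

text \<open>Lagrange's identity gives |x_t x x_v|^2 = EG - F^2, and here F = 0. Both sides are
  nonnegative, so comparing squares suffices.\<close>

lemma norm_cross3_deriv_catenoid: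
  assumes "b > 0"
  shows "norm (cross3 (deriv_t (catenoid b) t v) (deriv_v (catenoid b) t v)) = b\<^sup>2 * (cosh t)\<^sup>2"
proof (rule power2_eq_imp_eq)
  show "(norm (cross3 (deriv_t (catenoid b) t v) (deriv_v (catenoid b) t v)))\<^sup>2
      = (b\<^sup>2 * (cosh t)\<^sup>2)\<^sup>2"
    using norm_cross_dot[of "deriv_t (catenoid b) t v" "deriv_v (catenoid b) t v"] assms
      coeff_F_catenoid[of b t v]
    by (simp add: coeff_F_def norm_deriv_t_catenoid norm_deriv_v_catenoid power2_eq_square ac_simps)
qed auto

lemma unit_normal_catenoid:
  assumes "b > 0"
  shows "unit_normal (catenoid b) t v = vector [- (cos v / cosh t), - (sin v / cosh t), tanh t]"
proof -
  have "cross3 (deriv_t (catenoid b) t v) (deriv_v (catenoid b) t v)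
      = vector [- b\<^sup>2 * cosh t * cos v, - b\<^sup>2 * cosh t * sin v,
          (b\<^sup>2 * (sinh t * cosh t)) * (cos v)\<^sup>2 + (b\<^sup>2 * (sinh t * cosh t)) * (sin v)\<^sup>2]"
    by (simp add: deriv_t_catenoid deriv_v_catenoid cross3_vector_3 vec_eq_iff forall_3
        power2_eq_square algebra_simps)
  then have eq: "cross3 (deriv_t (catenoid b) t v) (deriv_v (catenoid b) t v)
      = vector [- b\<^sup>2 * cosh t * cos v, - b\<^sup>2 * cosh t * sin v, b\<^sup>2 * (sinh t * cosh t)]"
    unfolding cos_sin_combine .
  show ?thesis
    \<comment> \<open>The norm is rewritten while the cross product is still symbolic; after
      \<open>eq\<close> its lemma would no longer match.\<close>
    unfolding unit_normal_def Let_def norm_cross3_deriv_catenoid[OF assms]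
    unfolding eq scaleR_vector_3
    using assms by (simp add: vec_eq_iff forall_3 tanh_def power2_eq_square)
qed

text \<open>Comes from the normalization itself, as the cross product has the positive norm
  \<open>b\<^sup>2 * (cosh t)\<^sup>2\<close>.\<close>

lemma norm_unit_normal_catenoid:
  assumes "b > 0"
  shows "norm (unit_normal (catenoid b) t v) = 1"
  using norm_cross3_deriv_catenoid[OF assms, of t v] assms
  by (simp add: unit_normal_def Let_def)

lemma coeff_L_catenoid:
  assumes "b > 0"
  shows "coeff_L (catenoid b) t v = - b"
proof -
  have "coeff_L (catenoid b) t v = - (b * (cos v)\<^sup>2 + b * (sin v)\<^sup>2)"
    by (simp add: coeff_L_def deriv_t_deriv_t_catenoid unit_normal_catenoid[OF assms]
        inner_vector_3 power2_eq_square)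
  then show ?thesis
    unfolding cos_sin_combine .
qed

lemma coeff_M_catenoid:
  assumes "b > 0"
  shows "coeff_M (catenoid b) t v = 0"
  by (simp add: coeff_M_def deriv_v_deriv_t_catenoid unit_normal_catenoid[OF assms] inner_vector_3)

text \<open>Since x_vv = - x_tt, this is the opposite of L; together with E = G it explains why the
  mean curvature vanishes.\<close>

lemma coeff_N_catenoid:
  assumes "b > 0"
  shows "coeff_N (catenoid b) t v = b"
proof -
  have "coeff_N (catenoid b) t v = b * (cos v)\<^sup>2 + b * (sin v)\<^sup>2"
    by (simp add: coeff_N_def deriv_v_deriv_v_catenoid unit_normal_catenoid[OF assms]
        inner_vector_3 power2_eq_square)
  then show ?thesis
    unfolding cos_sin_combine .
qed

lemmas coeffs_catenoid = coeff_E_catenoid coeff_F_catenoid coeff_G_catenoid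
  coeff_L_catenoid coeff_M_catenoid coeff_N_catenoid

section \<open>Principal and Gaussian curvatures\<close>

lemma principal_curvature1_catenoid:
  assumes "b > 0"
  shows "principal_curvature1 (catenoid b) t v = - 1 / (b * (cosh t)\<^sup>2)"
  using assms by (simp add: principal_curvature1_def coeffs_catenoid power2_eq_square)

lemma principal_curvature2_catenoid:
  assumes "b > 0"
  shows "principal_curvature2 (catenoid b) t v = 1 / (b * (cosh t)\<^sup>2)"
  using assms by (simp add: principal_curvature2_def coeffs_catenoid power2_eq_square)

lemma gauss_curvature_catenoid:
  assumes "b > 0"
  shows "gauss_curvature (catenoid b) t v = - 1 / (b\<^sup>2 * (cosh t)^4)"
  using assms by (simp add: gauss_curvature_def coeffs_catenoid power2_eq_square power4_eq_xxxx)

section \<open>Parallels and their geodesic curvature\<close>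

text \<open>Shows that the claim about all arc-length parallels is not vacuous.\<close>

lemma arc_length_parallel_catenoid:
  assumes "b > 0"
  shows "arc_length_parallel (catenoid b) t (\<lambda>s. (t, s / (b * cosh t)))"
proof -
  define R where "R = b * cosh t"
  have R: "R > 0"
    using assms by (simp add: R_def)
  have d: "((\<lambda>s. s / R) has_real_derivative 1 / R) (at s)" for s
    using R by (auto intro!: derivative_eq_intros)
  have "surj (\<lambda>s. s / R)"
    using R by (intro surjI[where f = "\<lambda>y. y * R"]) simp
  moreover have "(\<lambda>s. s / R) differentiable at s \<and> deriv (\<lambda>s. s / R) s > 0" for s
    using d[of s] R by (auto simp: DERIV_imp_deriv real_differentiable_def)
  moreover have "arc_length_parametrized (surface_curve (catenoid b) (\<lambda>s. (t, s / R)))"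
    unfolding arc_length_parametrized_def
  proof
    fix s
    \<comment> \<open>The chain rule factor 1 / R cancels the radius, leaving a unit vector.\<close>
    have "((\<lambda>s. vector [R * cos (s / R), R * sin (s / R), b * t] :: real^3)
        has_vector_derivative vector [- sin (s / R), cos (s / R), 0]) (at s)"
      by (rule has_vector_derivative_vector_3) (use R in \<open>auto intro!: derivative_eq_intros\<close>)
    then have D: "(surface_curve (catenoid b) (\<lambda>s. (t, s / R))
        has_vector_derivative vector [- sin (s / R), cos (s / R), 0]) (at s)"
      by (simp add: surface_curve_def[abs_def] catenoid_def surface_of_revolution_def R_def)
    then show "surface_curve (catenoid b) (\<lambda>s. (t, s / R)) differentiable at s
        \<and> norm (velocity (surface_curve (catenoid b) (\<lambda>s. (t, s / R))) s) = 1"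
      by (auto simp: velocity_def vector_derivative_at norm_vector_3 intro: differentiableI_vector)
  qed
  ultimately show ?thesis
    unfolding arc_length_parallel_def R_def[symmetric]
    by (intro conjI exI[of _ "\<lambda>s. s / R"]) auto
qed

text \<open>For an arbitrary arc-length parallel, unit speed determines \<phi> up to a starting
  angle. Only the constant value of its derivative enters the computation, and the angle disappears
  with the last sum of squares.\<close>

lemma geodesic_curvature_catenoid:
  assumes "b > 0" and "arc_length_parallel (catenoid b) t c"
  shows "geodesic_curvature (catenoid b) c s = sinh t / (b * (cosh t)\<^sup>2)"
proof -
  define R where "R = b * cosh t"
  have R: "R > 0"
    using assms by (simp add: R_def)
  obtain \<phi> where c: "c = (\<lambda>s. (t, \<phi> s))"
    and \<phi>: "\<And>s. \<phi> differentiable at s" "\<And>s. deriv \<phi> s > 0"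
    and al: "arc_length_parametrized (surface_curve (catenoid b) c)"
    using assms(2) unfolding arc_length_parallel_def by blast
  have d: "(\<phi> has_real_derivative deriv \<phi> s) (at s)" for s
    using \<phi>(1) by (simp add: DERIV_deriv_iff_real_differentiable)
  have curve: "surface_curve (catenoid b) c
      = (\<lambda>s. vector [R * cos (\<phi> s), R * sin (\<phi> s), b * t])"
    by (simp add: fun_eq_iff surface_curve_def catenoid_def surface_of_revolution_def c R_def)
  have vel: "velocity (surface_curve (catenoid b) c) s
      = (R * deriv \<phi> s) *\<^sub>R vector [- sin (\<phi> s), cos (\<phi> s), 0]" for s
    unfolding velocity_def curve scaleR_vector_3
    by (rule vector_derivative_vector_3_at) (use d in \<open>auto intro!: derivative_eq_intros\<close>)
  \<comment> \<open>Unit speed says R |\<phi>'| = 1; the orientation \<phi>' > 0 selects the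
    sign.\<close>
  have speed: "deriv \<phi> s = 1 / R" for s
  proof -
    have "norm (velocity (surface_curve (catenoid b) c) s) = 1"
      using al by (simp add: arc_length_parametrized_def)
    then show ?thesis
      using R \<phi>(2)[of s] by (simp add: vel norm_vector_3 abs_mult field_simps)
  qed
  \<comment> \<open>An equation between functions, since the velocity is differentiated once
    more.\<close>
  have vel': "velocity (surface_curve (catenoid b) c)
      = (\<lambda>s. vector [- sin (\<phi> s), cos (\<phi> s), 0])"
    using R by (simp add: fun_eq_iff vel speed)
  have acc: "velocity (velocity (surface_curve (catenoid b) c)) s
      = vector [- cos (\<phi> s) / R, - sin (\<phi> s) / R, 0]"
    unfolding vel'
    unfolding velocity_def
    by (rule vector_derivative_vector_3_at)
      (use d[of s] in \<open>auto intro!: derivative_eq_intros simp: speed\<close>)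
  \<comment> \<open>Here R is also the length of x_t. Written as a multiple of x_t, the vector
    visibly lies in the tangent plane.\<close>
  have n_cross: "cross3 (unit_normal (catenoid b) t (\<phi> s)) (vector [- sin (\<phi> s), cos (\<phi> s), 0])
      = (- 1 / R) *\<^sub>R deriv_t (catenoid b) t (\<phi> s)"
  proof -
    have "cross3 (unit_normal (catenoid b) t (\<phi> s)) (vector [- sin (\<phi> s), cos (\<phi> s), 0])
      = vector [- tanh t * cos (\<phi> s), - tanh t * sin (\<phi> s),
          (- 1 / cosh t) * (cos (\<phi> s))\<^sup>2 + (- 1 / cosh t) * (sin (\<phi> s))\<^sup>2]"
      by (simp add: unit_normal_catenoid[OF assms(1)] cross3_vector_3 power2_eq_square)
    then show ?thesis
      unfolding cos_sin_combine
      using assms(1) by (simp add: deriv_t_catenoid scaleR_vector_3 R_def tanh_def)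
  qed
  have "conormal (catenoid b) c s
      = cross3 (unit_normal (catenoid b) t (\<phi> s)) (vector [- sin (\<phi> s), cos (\<phi> s), 0])"
  proof (rule conormal_eq)
    show "c s = (t, \<phi> s)" by (simp add: c)
    show "velocity (surface_curve (catenoid b) c) s = vector [- sin (\<phi> s), cos (\<phi> s), 0]"
      by (simp add: vel')
    show "norm (vector [- sin (\<phi> s), cos (\<phi> s), 0] :: real^3) = 1"
      by (simp add: norm_vector_3)
    show "norm (unit_normal (catenoid b) t (\<phi> s)) = 1"
      using assms(1) by (rule norm_unit_normal_catenoid)
    show "vector [- sin (\<phi> s), cos (\<phi> s), 0] \<bullet> unit_normal (catenoid b) t (\<phi> s) = 0"
      by (simp add: unit_normal_catenoid[OF assms(1)] inner_vector_3)
    show "cross3 (unit_normal (catenoid b) t (\<phi> s)) (vector [- sin (\<phi> s), cos (\<phi> s), 0])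
        \<in> span {deriv_t (catenoid b) t (\<phi> s), deriv_v (catenoid b) t (\<phi> s)}"
      unfolding n_cross by (intro span_scale span_base) simp
  qed
  then have "geodesic_curvature (catenoid b) c s
      = (b * sinh t / R\<^sup>2) * (cos (\<phi> s))\<^sup>2 + (b * sinh t / R\<^sup>2) * (sin (\<phi> s))\<^sup>2"
    unfolding geodesic_curvature_def acc n_cross
    by (simp add: deriv_t_catenoid scaleR_vector_3 inner_vector_3 power2_eq_square ac_simps)
  then show ?thesis
    unfolding cos_sin_combine using assms(1) by (simp add: R_def power2_eq_square)
qed

section \<open>Total curvature over a rectangle\<close>

text \<open>Fubini for an integrand depending on t alone: integration over v contributes the length
  v2 - v1, and the fundamental theorem of calculus handles t.\<close>

lemma set_lebesgue_integral_rectangle_fst: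
  fixes h H :: "real \<Rightarrow> real"
  assumes "\<And>t. t \<in> {t1..t2} \<Longrightarrow> (H has_real_derivative h t) (at t)" "continuous_on {t1..t2} h"
    and "t1 \<le> t2" "v1 \<le> v2"
  shows "(LINT p:({t1..t2} \<times> {v1..v2})|lborel. h (fst p)) = (v2 - v1) * (H t2 - H t1)"
proof -
  have box: "{t1..t2} \<times> {v1..v2} = cbox (t1, v1) (t2, v2)"
    by (simp add: cbox_Pair_eq)
  have cont: "continuous_on (cbox (t1, v1) (t2, v2)) (\<lambda>p. h (fst p))"
    unfolding box[symmetric]
    by (rule continuous_on_compose2[OF assms(2)]) (auto intro!: continuous_intros)
  have "set_integrable lborel (cbox (t1, v1) (t2, v2)) (\<lambda>p. h (fst p))"
    unfolding set_integrable_def by (intro borel_integrable_compact compact_cbox cont)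
  \<comment> \<open>From the Lebesgue to the gauge integral, where iterated integration and the
    fundamental theorem are applied.\<close>
  then have "(LINT p:({t1..t2} \<times> {v1..v2})|lborel. h (fst p))
      = integral (cbox (t1, v1) (t2, v2)) (\<lambda>p. h (fst p))"
    unfolding box by (rule set_borel_integral_eq_integral)
  also have "\<dots> = integral {t1..t2} (\<lambda>t. (v2 - v1) * h t)"
    using assms(4) by (simp add: integral_prod_continuous[OF cont])
  also have "\<dots> = (v2 - v1) * integral {t1..t2} h"
    by simp
  also have "integral {t1..t2} h = H t2 - H t1"
    using assms(1,3)
    by (intro integral_unique fundamental_theorem_of_calculus)
      (auto simp: has_real_derivative_iff_has_vector_derivative[symmetric]
        intro: has_field_derivative_at_within)
  finally show ?thesis .
qed

lemma total_curvature_catenoid: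
  assumes "b > 0" "t1 \<le> t2" "v1 \<le> v2"
  shows "total_curvature (catenoid b) t1 t2 v1 v2 = - (v2 - v1) * (tanh t2 - tanh t1)"
proof -
  \<comment> \<open>The area factor \<open>b\<^sup>2 * (cosh t)\<^sup>2\<close> cancels every power
    of b, so the total curvature is independent of the scale.\<close>
  have density: "gauss_curvature (catenoid b) t v *
      (norm (deriv_t (catenoid b) t v) * norm (deriv_v (catenoid b) t v)) = - 1 / (cosh t)\<^sup>2" for t v
    using assms(1)
    by (simp add: gauss_curvature_catenoid norm_deriv_t_catenoid norm_deriv_v_catenoid
        power2_eq_square power4_eq_xxxx)
  have "((\<lambda>t. - tanh t) has_real_derivative - 1 / (cosh t)\<^sup>2) (at t)" for t :: real
  proof -
    \<comment> \<open>The differentiation rule for \<open>tanh\<close> yields the left-hand form,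
      whereas the density has the right-hand one.\<close>
    have "1 - (tanh t)\<^sup>2 = 1 / (cosh t)\<^sup>2"
      by (simp add: tanh_def power_divide sinh_square_eq divide_simps)
    then show ?thesis
      by (auto intro!: derivative_eq_intros)
  qed
  moreover have "continuous_on {t1..t2} (\<lambda>t. - 1 / (cosh t)\<^sup>2)"
    by (auto intro!: continuous_intros)
  ultimately have "total_curvature (catenoid b) t1 t2 v1 v2
      = (v2 - v1) * (- tanh t2 - - tanh t1)"
    unfolding total_curvature_def density
    by (intro set_lebesgue_integral_rectangle_fst assms)
  then show ?thesis
    by (simp add: algebra_simps)
qed

theorem mainTheorem4:
  fixes b :: real and f g :: "real \<Rightarrow> real" and x :: "real \<Rightarrow> real \<Rightarrow> real^3"
  assumes "b > 0"
    and "f = (\<lambda>t. b * cosh t)"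
    and "g = (\<lambda>t. b * t)"
    and "x = surface_of_revolution f g"
  shows "(\<forall>t v.
      unit_normal x t v = vector [- (cos v / cosh t), - (sin v / cosh t), tanh t] \<and>
      coeff_E x t v = b\<^sup>2 * (cosh t)\<^sup>2 \<and>
      coeff_F x t v = 0 \<and>
      coeff_G x t v = b\<^sup>2 * (cosh t)\<^sup>2 \<and>
      coeff_L x t v = - b \<and>
      coeff_M x t v = 0 \<and>
      coeff_N x t v = b \<and>
      principal_curvature1 x t v = - 1 / (b * (cosh t)\<^sup>2) \<and>
      principal_curvature2 x t v = 1 / (b * (cosh t)\<^sup>2) \<and>
      mean_curvature x t v = 0 \<and>
      gauss_curvature x t v = - 1 / (b\<^sup>2 * (cosh t)^4)) \<and>
    (\<forall>t. (\<exists>c. arc_length_parallel x t c) \<and>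
      (\<forall>c s. arc_length_parallel x t c \<longrightarrow>
        geodesic_curvature x c s = sinh t / (b * (cosh t)\<^sup>2))) \<and>
    (\<forall>t1 t2 v1 v2. t1 < t2 \<longrightarrow> v1 < v2 \<longrightarrow>
      total_curvature x t1 t2 v1 v2 = - (v2 - v1) * (tanh t2 - tanh t1))"
proof -
  have x: "x = catenoid b"
    using assms by (simp add: catenoid_def)
  show ?thesis
    unfolding x
    using assms(1) arc_length_parallel_catenoid[OF assms(1)]
    by (auto simp: unit_normal_catenoid coeffs_catenoid mean_curvature_def
        principal_curvature1_catenoid principal_curvature2_catenoid gauss_curvature_catenoid
        geodesic_curvature_catenoid total_curvature_catenoid)
qed

end
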